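(* Let $U,V\subset\mathbb{R}^n$ be open, let $\Phi:U\to V$ be a $C^1$-diffeomorphism, let $A\subset\mathbb{R}^n$, let $x\in\overline A\cap U$, and set $y:=\Phi(x)$ and $B:=\Phi(A\cap U)$. Then \[ \dim_{\times}\{y\}_B=\dim_{\times}\{x\}_A. \] Equivalently, \[ \dim_{\times}\{\Phi(x)\}_{\Phi(A\cap U)}=\dim_{\times}\{x\}_A. \]
   Context: Tangent cone: for $A\subset\mathbb{R}^n$, $\mathrm{Tan}_x(A)$ is the set of $v\in\mathbb{R}^n$ for which there exist $x_k\in A$, $x_k\to x$, and positive reals $\lambda_k\downarrow0$ with $(x_k-x)/\lambda_k\to v$. Effective directions: $\mathrm{Eff}_x(A):=\mathrm{Tan}_x(A)\cap S^{n-1}$ if $x\in\overline A$ (and $\varnothing$ otherwise). For $v\ne0$ let $[v]=\mathbb{R}v\in\mathbb{P}^{n-1}$; $\mathrm{Eff}_x^{\mathbb P}(A):=\{[v]:v\in\mathrm{Eff}_x(A)\}$. Admissible probes: for $x\in\overline A$, $v\in S^{n-1}$, $\mathcal G_x^A(v)$ is the family of all injective Lipschitz maps $\gamma:[0,\delta]\to\mathbb{R}^n$ (some $\delta>0$) with $\gamma(0)=x$, $\lim_{t\to0^+}\frac{\gamma(t)-x}{\|\gamma(t)-x\|}=v$, and $A\cap\gamma((0,\eta])\ne\varnothing$ for every $\eta\in(0,\delta]$; $\Gamma_\gamma:=\gamma([0,\delta])$. Point-extended box dimension: for bounded $E$, $N_\varepsilon(E)$ is the minimal number of sets of diameter at most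 $\varepsilon$ covering $E$ and $\overline{\dim}_B(E):=\limsup_{\varepsilon\to0}\frac{\ln N_\varepsilon(E)}{\ln(1/\varepsilon)}$. For $x\in\overline E$, $\dim_{\mathrm{Pbox}}\{x\}_E:=\inf_{r>0}\overline{\dim}_B(E\cap B(x,r))$; it is $0$ if $x\notin\overline E$. Directional contribution: for $v\in\mathrm{Eff}_x(A)$, $\theta_x^A(v):=\sup_{\gamma\in\mathcal G_x^A(v)}\dim_{\mathrm{Pbox}}\{x\}_{A\cap\Gamma_\gamma}$; for $\xi\in\mathrm{Eff}_x^{\mathbb P}(A)$, $\theta_x^A(\xi):=\sup\{\theta_x^A(w):w\in\mathrm{Eff}_x(A),[w]=\xi\}$. Point-Cross dimension at $x\in\overline A$: $\dim_\times\{x\}_A:=\sup\sum_{i=1}^m\theta_x^A(\xi_i)$ over all $m\in\{0,\dots,n\}$ and all $\xi_1,\dots,\xi_m\in\mathrm{Eff}_x^{\mathbb P}(A)$ that are projectively (linearly) independent, i.e. nonzero representatives are linearly independent (empty family allowed, with sum $0$). *)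

theory Defs
  imports "HOL-Analysis.Analysis"
begin

definition tangent_cone :: "'a::euclidean_space \<Rightarrow> 'a set \<Rightarrow> 'a set" where
  "tangent_cone x A = {v. \<exists>X l. (\<forall>k::nat. X k \<in> A) \<and> X \<longlonglongrightarrow> x \<and>
     (\<forall>k. l k > (0::real)) \<and> decseq l \<and> l \<longlonglongrightarrow> 0 \<and>
     (\<lambda>k. (X k - x) /\<^sub>R l k) \<longlonglongrightarrow> v}"

definition eff_dirs :: "'a::euclidean_space \<Rightarrow> 'a set \<Rightarrow> 'a set" where
  "eff_dirs x A = (if x \<in> closure A then tangent_cone x A \<inter> sphere 0 1 else {})"

text \<open>A point of projective space is represented by the line \<^term>\<open>span {v}\<close> it stands for
  (with \<^prop>\<open>v \<noteq> 0\<close>), as a set of vectors.\<close>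

definition proj_class :: "'a::euclidean_space \<Rightarrow> 'a set" where
  "proj_class v = span {v}"

definition proj_eff_dirs :: "'a::euclidean_space \<Rightarrow> 'a set \<Rightarrow> 'a set set" where
  "proj_eff_dirs x A = proj_class ` eff_dirs x A"

text \<open>A probe is a pair of the endpoint \<open>\<delta>\<close> and a map \<open>\<gamma>\<close>, of which only the values
  on \<open>{0..\<delta>}\<close> matter.\<close>

definition probes :: "'a::euclidean_space \<Rightarrow> 'a set \<Rightarrow> 'a \<Rightarrow> (real \<times> (real \<Rightarrow> 'a)) set" where
  "probes x A v = {(\<delta>, \<gamma>). \<delta> > 0 \<and> inj_on \<gamma> {0..\<delta>} \<and> (\<exists>L. L-lipschitz_on {0..\<delta>} \<gamma>) \<and>
     \<gamma> 0 = x \<and>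
     ((\<lambda>t. (\<gamma> t - x) /\<^sub>R norm (\<gamma> t - x)) \<longlongrightarrow> v) (at_right 0) \<and>
     (\<forall>\<eta>\<in>{0<..\<delta>}. A \<inter> \<gamma> ` {0<..\<eta>} \<noteq> {})}"

text \<open>Boundedness of the covering sets is required explicitly, since \<^const>\<open>diameter\<close> is a
  meaningless real number on unbounded sets.\<close>

definition covering_number :: "real \<Rightarrow> 'a::euclidean_space set \<Rightarrow> nat" where
  "covering_number \<epsilon> E = (LEAST m. \<exists>\<C>. finite \<C> \<and> card \<C> = m \<and> E \<subseteq> \<Union>\<C> \<and>
     (\<forall>S\<in>\<C>. bounded S \<and> diameter S \<le> \<epsilon>))"

text \<open>The intended argument is a bounded set. Dimensions are extended reals so that
  every supremum and infimum below exists.\<close>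

definition upper_box_dim :: "'a::euclidean_space set \<Rightarrow> ereal" where
  "upper_box_dim E =
     Limsup (at_right 0) (\<lambda>\<epsilon>. ereal (ln (real (covering_number \<epsilon> E)) / ln (1 / \<epsilon>)))"

definition point_box_dim :: "'a::euclidean_space \<Rightarrow> 'a set \<Rightarrow> ereal" where
  "point_box_dim x E =
     (if x \<in> closure E then (INF r\<in>{0<..}. upper_box_dim (E \<inter> ball x r)) else 0)"

text \<open>Intended for effective directions \<open>v\<close>; these always admit a probe, so the supremum is over a
  nonempty set (in \<^typ>\<open>ereal\<close> the supremum of the empty set would be \<open>-\<infinity>\<close>).\<close>

definition dir_contrib :: "'a::euclidean_space \<Rightarrow> 'a set \<Rightarrow> 'a \<Rightarrow> ereal" where
  "dir_contrib x A v = (SUP (\<delta>, \<gamma>)\<in>probes x A v. point_box_dim x (A \<inter> \<gamma> ` {0..\<delta>}))"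

definition proj_contrib :: "'a::euclidean_space \<Rightarrow> 'a set \<Rightarrow> 'a set \<Rightarrow> ereal" where
  "proj_contrib x A \<xi> = (SUP w\<in>{w \<in> eff_dirs x A. proj_class w = \<xi>}. dir_contrib x A w)"

text \<open>Linear independence of the family \<open>u 1, \<dots>, u m\<close> of representatives is injectivity of the
  indexing together with \<^const>\<open>independent\<close> for the set of its members.\<close>

definition proj_independent :: "nat \<Rightarrow> (nat \<Rightarrow> 'a::euclidean_space set) \<Rightarrow> bool" where
  "proj_independent m \<xi> \<longleftrightarrow>
     (\<exists>u. (\<forall>i\<in>{1..m}. u i \<noteq> 0 \<and> proj_class (u i) = \<xi> i) \<and>
          inj_on u {1..m} \<and> independent (u ` {1..m}))"

definition point_cross_dim :: "'a::euclidean_space \<Rightarrow> 'a set \<Rightarrow> ereal" where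
  "point_cross_dim x A =
     (SUP (m, \<xi>)\<in>{(m, \<xi>). m \<le> DIM('a) \<and> (\<forall>i\<in>{1..m}. \<xi> i \<in> proj_eff_dirs x A) \<and>
                        proj_independent m \<xi>}.
        \<Sum>i=1..m. proj_contrib x A (\<xi> i))"

text \<open>Intended for open sets, so that derivatives are taken at interior points.\<close>

definition C1_on :: "'a::euclidean_space set \<Rightarrow> ('a \<Rightarrow> 'b::euclidean_space) \<Rightarrow> bool" where
  "C1_on U f \<longleftrightarrow> (\<exists>f' :: 'a \<Rightarrow> 'a \<Rightarrow>\<^sub>L 'b.
     (\<forall>x\<in>U. (f has_derivative blinfun_apply (f' x)) (at x)) \<and> continuous_on U f')"

definition C1_diffeomorphism ::
    "'a::euclidean_space set \<Rightarrow> 'b::euclidean_space set \<Rightarrow> ('a \<Rightarrow> 'b) \<Rightarrow> bool" where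
  "C1_diffeomorphism U V \<Phi> \<longleftrightarrow>
     bij_betw \<Phi> U V \<and> C1_on U \<Phi> \<and> C1_on V (inv_into U \<Phi>)"

end

theory Submission imports Defs begin

text \<open>A \<open>C\<^sup>1\<close>-diffeomorphism is bi-Lipschitz near \<open>x\<close> and differentiable at \<open>x\<close> with
  invertible derivative \<open>L\<close>. Composing with it turns probes at \<open>x\<close> in direction \<open>v\<close>, once
  shortened, into probes at \<open>y\<close> in direction \<open>sgn (L v)\<close>, and bi-Lipschitz maps do not change
  box dimensions. As \<open>L\<close> preserves linear independence of lines, every family that competes in
  the supremum at \<open>x\<close> is matched by one at \<open>y\<close> with at least the same value. The roles of the two
  sides are symmetric once the relation between the sets is written as
  \<open>\<Phi> ` (A \<inter> U) = B \<inter> V\<close>, which also makes passing from \<open>A\<close> to \<open>A \<inter> U\<close> harmless.\<close>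

section \<open>Box dimension and Lipschitz maps\<close>

lemma bounded_has_small_cover:
  fixes E :: "'a::euclidean_space set"
  assumes "bounded E" "\<epsilon> > 0"
  shows "\<exists>\<C>. finite \<C> \<and> E \<subseteq> \<Union>\<C> \<and> (\<forall>S\<in>\<C>. bounded S \<and> diameter S \<le> \<epsilon>)"
proof -
  have "compact (closure E)" using assms by simp
  then obtain k where k: "finite k" "closure E \<subseteq> (\<Union>x\<in>k. ball x (\<epsilon>/2))"
    using compact_eq_totally_bounded[of "closure E"] assms(2) half_gt_zero by meson
  have "diameter (ball x (\<epsilon>/2)) \<le> \<epsilon>" for x :: 'a
    using assms by (simp add: diameter_ball)
  then show ?thesis using k closure_subset[of E]
    by (intro exI[of _ "(\<lambda>x. ball x (\<epsilon>/2)) ` k"]) auto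
qed

text \<open>The \<open>LEAST\<close> in \<open>covering_number\<close> is attained because a bounded
  set is totally bounded, so the admissible cardinalities form a nonempty set.\<close>

lemma covering_number_cover:
  fixes E :: "'a::euclidean_space set"
  assumes "bounded E" "\<epsilon> > 0"
  obtains \<C> where "finite \<C>" "card \<C> = covering_number \<epsilon> E" "E \<subseteq> \<Union>\<C>"
    "\<And>S. S \<in> \<C> \<Longrightarrow> bounded S \<and> diameter S \<le> \<epsilon>"
proof -
  obtain \<C> where "finite \<C>" "E \<subseteq> \<Union>\<C>" "\<forall>S\<in>\<C>. bounded S \<and> diameter S \<le> \<epsilon>"
    using bounded_has_small_cover[OF assms] by blast
  then have "\<exists>m \<C>. finite \<C> \<and> card \<C> = m \<and> E \<subseteq> \<Union>\<C> \<and> (\<forall>S\<in>\<C>. bounded S \<and> diameter S \<le> \<epsilon>)"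
    by blast
  from LeastI_ex[OF this] obtain \<C> where "finite \<C>" "card \<C> = covering_number \<epsilon> E" "E \<subseteq> \<Union>\<C>"
    "\<forall>S\<in>\<C>. bounded S \<and> diameter S \<le> \<epsilon>"
    unfolding covering_number_def[symmetric] by (elim exE conjE)
  then show ?thesis by (intro that) auto
qed

lemma covering_number_le_card:
  assumes "finite \<C>" "E \<subseteq> \<Union>\<C>" "\<And>S. S \<in> \<C> \<Longrightarrow> bounded S \<and> diameter S \<le> \<epsilon>"
  shows "covering_number \<epsilon> E \<le> card \<C>"
  unfolding covering_number_def by (rule Least_le) (use assms in blast)

lemma covering_number_lipschitz_image:
  fixes F :: "'b::euclidean_space set" and g :: "'b \<Rightarrow> 'a::euclidean_space"
  assumes "bounded F" "\<epsilon> > 0" and lip: "M-lipschitz_on F g" and "E \<subseteq> g ` F"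
  shows "covering_number (M * \<epsilon>) E \<le> covering_number \<epsilon> F"
proof -
  obtain \<C> where \<C>: "finite \<C>" "card \<C> = covering_number \<epsilon> F" "F \<subseteq> \<Union>\<C>"
    "\<And>S. S \<in> \<C> \<Longrightarrow> bounded S \<and> diameter S \<le> \<epsilon>"
    using covering_number_cover[OF assms(1,2)] by metis
  have M: "M \<ge> 0" using lip by (rule lipschitz_on_nonneg)
  \<comment> \<open>Push an optimal cover forward. Each piece is first cut down to \<open>F\<close>,
    where alone the Lipschitz bound is available.\<close>
  have "covering_number (M * \<epsilon>) E \<le> card ((\<lambda>S. g ` (S \<inter> F)) ` \<C>)"
  proof (rule covering_number_le_card)
    show "E \<subseteq> \<Union> ((\<lambda>S. g ` (S \<inter> F)) ` \<C>)" using assms(4) \<C>(3) by fastforce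
  next
    fix T assume "T \<in> (\<lambda>S. g ` (S \<inter> F)) ` \<C>"
    then obtain S where S: "S \<in> \<C>" and T: "T = g ` (S \<inter> F)" by auto
    have bS: "bounded S" "diameter S \<le> \<epsilon>" using \<C>(4)[OF S] by auto
    have d: "dist a b \<le> M * \<epsilon>" if ab: "a \<in> T" "b \<in> T" for a b
    proof -
      obtain p q where pq: "p \<in> S" "p \<in> F" "q \<in> S" "q \<in> F" "a = g p" "b = g q"
        using ab T by auto
      have "dist a b \<le> M * dist p q" using lipschitz_onD[OF lip] pq by auto
      also have "dist p q \<le> \<epsilon>" using diameter_bounded_bound[OF bS(1)] pq bS(2) by fastforce
      finally show ?thesis using M by (simp add: mult_left_mono)
    qed
    have "bounded T"
      unfolding bounded_two_points using d by blast
    moreover have "diameter T \<le> M * \<epsilon>"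
      by (rule diameter_le) (use d M assms(2) in \<open>auto simp: dist_norm\<close>)
    ultimately show "bounded T \<and> diameter T \<le> M * \<epsilon>" by blast
  qed (use \<C>(1) in simp)
  also have "\<dots> \<le> card \<C>" using \<C>(1) by (rule card_image_le)
  finally show ?thesis using \<C>(2) by simp
qed

text \<open>Rescaling adds only the constant \<open>ln M\<close> to the numerator, which is lost
  against the divergent \<open>ln (1 / \<epsilon>)\<close>. This is why Lipschitz constants leave no
  trace in box dimensions.\<close>

lemma tendsto_ln_scaled_ratio:
  assumes "M > (0::real)"
  shows "((\<lambda>\<epsilon>. ln (1 / (\<epsilon> / M)) / ln (1 / \<epsilon>)) \<longlongrightarrow> 1) (at_right 0)"
proof -
  have lim: "filterlim (\<lambda>\<epsilon>::real. ln (1 / \<epsilon>)) at_top (at_right 0)"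
    using filterlim_compose[OF ln_at_top filterlim_inverse_at_top_right]
    by (simp add: inverse_eq_divide)
  have "((\<lambda>\<epsilon>. ln M / ln (1 / \<epsilon>) + 1) \<longlongrightarrow> 0 + 1) (at_right 0)"
    by (intro tendsto_add tendsto_const real_tendsto_divide_at_top[OF tendsto_const lim])
  moreover have "\<forall>\<^sub>F \<epsilon> in at_right 0. ln M / ln (1 / \<epsilon>) + 1 = ln (1 / (\<epsilon> / M)) / ln (1 / \<epsilon>)"
    using eventually_at_right_less[of "0::real"] filterlim_at_top_dense[THEN iffD1, OF lim, rule_format, of 0]
  proof eventually_elim
    case (elim \<epsilon>)
    have "ln (1 / (\<epsilon> / M)) = ln M + ln (1 / \<epsilon>)"
      using elim assms by (simp add: ln_div)
    then show ?case using elim by (simp add: add_divide_distrib)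
  qed
  ultimately show ?thesis by (simp add: tendsto_cong)
qed

lemma upper_box_dim_lipschitz_image:
  fixes F :: "'b::euclidean_space set" and g :: "'b \<Rightarrow> 'a::euclidean_space"
  assumes bd: "bounded F" and lip: "M-lipschitz_on F g" and sub: "E \<subseteq> g ` F"
  shows "upper_box_dim E \<le> upper_box_dim F"
proof -
  \<comment> \<open>A Lipschitz constant may be 0; enlarging it makes division by \<open>K\<close>
    legitimate.\<close>
  define K where "K = max M 1"
  have K: "K > 0" "K-lipschitz_on F g"
    unfolding K_def using lip by (auto intro: lipschitz_on_le)
  define \<rho> where "\<rho> \<epsilon> = ln (real (covering_number \<epsilon> F)) / ln (1 / \<epsilon>)" for \<epsilon>
  have "filterlim (\<lambda>\<epsilon>. \<epsilon> / K) (at_right 0) (at_right 0)"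
  proof (rule filterlim_at_withinI)
    show "((\<lambda>\<epsilon>. \<epsilon> / K) \<longlongrightarrow> 0) (at_right 0)"
      using K by (auto intro!: tendsto_eq_intros)
    show "\<forall>\<^sub>F \<epsilon> in at_right 0. \<epsilon> / K \<in> {0<..} - {0}"
      using eventually_at_right_less[of "0::real"] by eventually_elim (use K in auto)
  qed
  note scale = this[unfolded filterlim_iff, rule_format]
  have "Limsup (at_right 0) (\<lambda>\<epsilon>. ereal (ln (real (covering_number \<epsilon> E)) / ln (1 / \<epsilon>))) \<le> ereal c"
    if c: "Limsup (at_right 0) (\<lambda>\<epsilon>. ereal (\<rho> \<epsilon>)) < ereal c" for c
  proof -
    have "\<forall>\<^sub>F \<epsilon> in at_right 0. ereal (\<rho> \<epsilon>) < ereal c" using Limsup_lessD[OF c] .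
    then have ev: "\<forall>\<^sub>F \<epsilon> in at_right 0. \<rho> (\<epsilon> / K) < c" using scale by force
    \<comment> \<open>Below 1 and below \<open>K\<close>, both logarithms
      \<open>ln (1 / \<epsilon>)\<close> and \<open>ln (1 / (\<epsilon> / K))\<close> are
      positive.\<close>
    have small: "\<forall>\<^sub>F \<epsilon> in at_right (0::real). \<epsilon> \<in> {0<..<min 1 K}"
      using K by (intro eventually_at_right_real) auto
    have le: "\<forall>\<^sub>F \<epsilon> in at_right 0.
        ereal (ln (real (covering_number \<epsilon> E)) / ln (1 / \<epsilon>))
          \<le> ereal (c * (ln (1 / (\<epsilon> / K)) / ln (1 / \<epsilon>)))"
      using ev small
    proof eventually_elim
      case (elim \<epsilon>)
      have pos: "ln (1 / \<epsilon>) > 0" "ln (1 / (\<epsilon> / K)) > 0"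
        using elim by (auto intro!: ln_gt_zero simp: field_simps)
      have "covering_number (K * (\<epsilon> / K)) E \<le> covering_number (\<epsilon> / K) F"
        by (rule covering_number_lipschitz_image) (use bd K sub elim in auto)
      then have "covering_number \<epsilon> E \<le> covering_number (\<epsilon> / K) F" using K by simp
      then have "ln (real (covering_number \<epsilon> E)) \<le> ln (real (covering_number (\<epsilon> / K) F))"
        \<comment> \<open>The covering number 0 of an empty set is treated apart, since monotonicity
          of \<open>ln\<close> holds only on positive arguments.\<close>
        by (cases "covering_number \<epsilon> E = 0"; cases "covering_number (\<epsilon> / K) F = 0")
           (auto simp: Suc_le_eq)
      also have "\<dots> = \<rho> (\<epsilon> / K) * ln (1 / (\<epsilon> / K))" unfolding \<rho>_def using pos by simp
      also have "\<dots> \<le> c * ln (1 / (\<epsilon> / K))"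
        using elim pos by (intro mult_right_mono) auto
      finally show ?case using pos by (simp add: divide_right_mono)
    qed
    have "((\<lambda>\<epsilon>. ereal (c * (ln (1 / (\<epsilon> / K)) / ln (1 / \<epsilon>)))) \<longlongrightarrow> ereal (c * 1)) (at_right 0)"
      by (intro tendsto_ereal tendsto_mult tendsto_const tendsto_ln_scaled_ratio K)
    then have "Limsup (at_right 0) (\<lambda>\<epsilon>. ereal (c * (ln (1 / (\<epsilon> / K)) / ln (1 / \<epsilon>)))) = ereal c"
      by (simp add: lim_imp_Limsup)
    then show ?thesis using Limsup_mono[OF le] by simp
  qed
  then have *: "upper_box_dim E \<le> ereal c" if "upper_box_dim F < ereal c" for c
    using that unfolding upper_box_dim_def \<rho>_def by blast
  show ?thesis
  \<comment> \<open>The estimate so far concerns real bounds \<open>c\<close>; density of the reals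
    in \<open>ereal\<close> extends it to dimensions that might be infinite.\<close>
  proof (rule dense_ge)
    fix z assume "upper_box_dim F < z"
    then obtain c where "upper_box_dim F < ereal c" "ereal c < z" using ereal_dense2 by blast
    then show "upper_box_dim E \<le> z" using *[of c] by auto
  qed
qed

lemma upper_box_dim_mono:
  fixes F :: "'a::euclidean_space set"
  assumes "bounded F" "E \<subseteq> F"
  shows "upper_box_dim E \<le> upper_box_dim F"
proof (rule upper_box_dim_lipschitz_image[OF assms(1)])
  show "1-lipschitz_on F (\<lambda>z. z)" by (rule lipschitz_on_id)
qed (use assms(2) in simp)

text \<open>An infimum over radii sees only germs. The inclusion is therefore asked for small balls
  only, which suits a probe whose image is available only after shortening.\<close>

lemma point_box_dim_lipschitz_germ:
  fixes x :: "'a::euclidean_space" and y :: "'b::euclidean_space"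
  assumes x: "x \<in> closure E" and y: "y \<in> closure F"
    and "e > 0" and lip: "M-lipschitz_on (ball y e) g"
    and germ: "\<And>r. r > 0 \<Longrightarrow> \<exists>s>0. E \<inter> ball x s \<subseteq> g ` (F \<inter> ball y r)"
  shows "point_box_dim x E \<le> point_box_dim y F"
proof -
  have "(INF r\<in>{0<..}. upper_box_dim (E \<inter> ball x r)) \<le> upper_box_dim (F \<inter> ball y r)"
    if r: "r > 0" for r
  proof -
    \<comment> \<open>The radius \<open>r\<close> may exceed the one on which \<open>g\<close> is
      Lipschitz; monotonicity brings the bound back to \<open>r\<close>.\<close>
    have "min r e > 0" using r \<open>e > 0\<close> by simp
    then obtain s where s: "s > 0" "E \<inter> ball x s \<subseteq> g ` (F \<inter> ball y (min r e))"
      using germ by blast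
    have "upper_box_dim (E \<inter> ball x s) \<le> upper_box_dim (F \<inter> ball y (min r e))"
    proof (rule upper_box_dim_lipschitz_image)
      show "bounded (F \<inter> ball y (min r e))" by (simp add: bounded_Int)
      show "M-lipschitz_on (F \<inter> ball y (min r e)) g" by (rule lipschitz_on_subset[OF lip]) auto
    qed (rule s)
    also have "\<dots> \<le> upper_box_dim (F \<inter> ball y r)"
      by (rule upper_box_dim_mono) (auto simp: bounded_Int)
    finally have "upper_box_dim (E \<inter> ball x s) \<le> upper_box_dim (F \<inter> ball y r)" .
    then show ?thesis using s(1) by (meson INF_lower2 greaterThan_iff)
  qed
  then show ?thesis unfolding point_box_dim_def using x y by (auto intro!: INF_greatest)
qed

section \<open>Maps with a bi-Lipschitz and differentiable germ\<close>

lemma sgn_scaleR_norm: "z /\<^sub>R norm z = sgn (z::'a::real_normed_vector)"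
  by (simp add: sgn_div_norm)

text \<open>The filter and the scale \<open>c\<close> are left general so that one computation
  serves both the sequences of the tangent cone and the probes. The remainder tends to 0 and is
  multiplied by a factor whose absolute value tends to \<open>norm v\<close>.\<close>

lemma has_derivative_tendsto_scaled:
  fixes f :: "'a::real_normed_vector \<Rightarrow> 'b::real_normed_vector"
  assumes der: "(f has_derivative L) (at x)"
    and z: "(z \<longlongrightarrow> x) F" and v: "((\<lambda>t. (z t - x) /\<^sub>R c t) \<longlongrightarrow> v) F"
  shows "((\<lambda>t. (f (z t) - f x) /\<^sub>R c t) \<longlongrightarrow> L v) F"
proof -
  interpret L: bounded_linear L using der by (rule has_derivative_bounded_linear)
  define R where "R p = (f p - f x - L (p - x)) /\<^sub>R norm (p - x)" for p
  \<comment> \<open>Division by zero gives \<open>R x = 0\<close>, so \<open>R\<close> is continuous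
    at \<open>x\<close> itself and \<open>z t = x\<close> is allowed.\<close>
  have "isCont R x"
    using der unfolding has_derivative_at_within isCont_def R_def by simp
  then have R: "((\<lambda>t. R (z t)) \<longlongrightarrow> 0) F"
    using isCont_tendsto_compose[OF _ z, of R] by (simp add: R_def)
  have "((\<lambda>t. L ((z t - x) /\<^sub>R c t) + (norm (z t - x) / c t) *\<^sub>R R (z t)) \<longlongrightarrow> L v + 0) F"
  proof (intro tendsto_add L.tendsto v)
    have "((\<lambda>t. norm ((z t - x) /\<^sub>R c t) *\<^sub>R norm (R (z t))) \<longlongrightarrow> norm v *\<^sub>R norm (0::'b)) F"
      by (intro tendsto_scaleR tendsto_norm v R)
    then have "((\<lambda>t. norm ((norm (z t - x) / c t) *\<^sub>R R (z t))) \<longlongrightarrow> 0) F"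
      by (simp add: divide_inverse mult.commute abs_mult)
    then show "((\<lambda>t. (norm (z t - x) / c t) *\<^sub>R R (z t)) \<longlongrightarrow> 0) F"
      by (rule tendsto_norm_zero_cancel)
  qed
  moreover have "L ((z t - x) /\<^sub>R c t) + (norm (z t - x) / c t) *\<^sub>R R (z t) = (f (z t) - f x) /\<^sub>R c t"
    for t
  proof (cases "z t = x")
    case False
    then have "(norm (z t - x) / c t) *\<^sub>R R (z t) = (f (z t) - f x - L (z t - x)) /\<^sub>R c t"
      by (simp add: R_def divide_inverse)
    then show ?thesis unfolding L.scaleR by (simp add: scaleR_right_diff_distrib)
  qed (simp add: L.zero)
  ultimately show ?thesis by simp
qed

section \<open>Base points of tangent cones and probes\<close>

lemma tangent_cone_imp_closure:
  assumes "v \<in> tangent_cone x A"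
  shows "x \<in> closure A"
  using assms by (auto simp: tangent_cone_def closure_sequential)

text \<open>This keeps \<open>point_box_dim\<close> at the start of a probe in its infimum branch.
  Arbitrarily short initial pieces of the probe meet \<open>A\<close>, and continuity brings these
  points close to \<open>x\<close>.\<close>

lemma probe_closure:
  assumes "(\<delta>, \<gamma>) \<in> probes x A v"
  shows "x \<in> closure (A \<inter> \<gamma> ` {0..\<delta>})"
proof -
  have \<delta>: "\<delta> > 0" and x: "\<gamma> 0 = x" and meet: "\<And>\<eta>. \<eta> \<in> {0<..\<delta>} \<Longrightarrow> A \<inter> \<gamma> ` {0<..\<eta>} \<noteq> {}"
    using assms unfolding probes_def by auto
  obtain C where C: "C-lipschitz_on {0..\<delta>} \<gamma>" using assms unfolding probes_def by auto
  have "continuous_on {0..\<delta>} \<gamma>" by (rule lipschitz_on_continuous_on[OF C])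
  show ?thesis unfolding closure_approachable
  proof (intro allI impI)
    fix e :: real assume "e > 0"
    then obtain d where d: "d > 0" "\<And>t. t \<in> {0..\<delta>} \<Longrightarrow> dist t 0 < d \<Longrightarrow> dist (\<gamma> t) (\<gamma> 0) < e"
      using \<open>continuous_on {0..\<delta>} \<gamma>\<close> \<delta> unfolding continuous_on_iff by (metis atLeastAtMost_iff order.refl less_imp_le)
    have "min \<delta> (d/2) \<in> {0<..\<delta>}" using \<delta> d by auto
    then obtain t where "t \<in> {0<..min \<delta> (d/2)}" "\<gamma> t \<in> A" using meet by fastforce
    then show "\<exists>p\<in>A \<inter> \<gamma> ` {0..\<delta>}. dist p x < e"
      using d x by (intro bexI[of _ "\<gamma> t"]) auto
  qed
qed

lemma inj_path_start_germ:
  fixes \<gamma> :: "real \<Rightarrow> 'a::heine_borel"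
  assumes "continuous_on {0..\<delta>} \<gamma>" "inj_on \<gamma> {0..\<delta>}" "0 < d" "d \<le> \<delta>"
  obtains s where "s > 0" "\<And>t. t \<in> {0..\<delta>} \<Longrightarrow> dist (\<gamma> 0) (\<gamma> t) < s \<Longrightarrow> t < d"
proof -
  have "compact (\<gamma> ` {d..\<delta>})"
    by (intro compact_continuous_image continuous_on_subset[OF assms(1)]) (use assms in auto)
  moreover have "\<gamma> 0 \<notin> \<gamma> ` {d..\<delta>}"
  proof
    assume "\<gamma> 0 \<in> \<gamma> ` {d..\<delta>}"
    then obtain t where "t \<in> {d..\<delta>}" "\<gamma> 0 = \<gamma> t" by auto
    then show False using inj_onD[OF assms(2), of 0 t] assms by auto
  qed
  ultimately have "\<exists>s>0. \<forall>p\<in>\<gamma> ` {d..\<delta>}. s \<le> dist (\<gamma> 0) p"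
    by (intro separate_point_closed compact_imp_closed)
  then obtain s where s: "s > 0" "\<And>p. p \<in> \<gamma> ` {d..\<delta>} \<Longrightarrow> s \<le> dist (\<gamma> 0) p"
    by auto
  show ?thesis
  proof (rule that[OF s(1)])
    fix t assume t: "t \<in> {0..\<delta>}" "dist (\<gamma> 0) (\<gamma> t) < s"
    show "t < d"
    proof (rule ccontr)
      assume "\<not> t < d"
      then show False using s(2)[of "\<gamma> t"] t by auto
    qed
  qed
qed

text \<open>A diffeomorphism is reduced to its data at one pair of points. Every assumption has its
  mirror image, so exchanging the two sides yields another instance.\<close>

locale point_diffeo =
  fixes U :: "'a::euclidean_space set" and V :: "'b::euclidean_space set"
    and \<Phi> :: "'a \<Rightarrow> 'b" and \<Psi> :: "'b \<Rightarrow> 'a" and L :: "'a \<Rightarrow> 'b" and L' :: "'b \<Rightarrow> 'a"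
    and x :: 'a and y :: 'b and A :: "'a set" and B :: "'b set"
  assumes open_U: "open U" and open_V: "open V"
    and x_in: "x \<in> U" and \<Phi>_x: "\<Phi> x = y" and image: "\<Phi> ` U = V"
    and inverse: "\<And>z. z \<in> U \<Longrightarrow> \<Psi> (\<Phi> z) = z"
    and der: "(\<Phi> has_derivative L) (at x)" and der': "(\<Psi> has_derivative L') (at y)"
    and lip: "\<exists>e>0. \<exists>M. M-lipschitz_on (ball x e) \<Phi>"
    and lip': "\<exists>e>0. \<exists>M. M-lipschitz_on (ball y e) \<Psi>"
    and sets: "\<Phi> ` (A \<inter> U) = B \<inter> V"
begin

section \<open>The inverse germ and the linear isomorphism \<open>L\<close>\<close>

lemma y_in: "y \<in> V"
  using x_in \<Phi>_x image by auto

lemma inverse': "w \<in> V \<Longrightarrow> \<Phi> (\<Psi> w) = w"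
  using image inverse by auto

lemma swap: "point_diffeo V U \<Psi> \<Phi> L' L y x B A"
proof
  show "\<Psi> y = x" using x_in \<Phi>_x inverse by auto
  show "\<Psi> ` V = U" using image inverse by force
  show "\<Psi> ` (B \<inter> V) = A \<inter> U" unfolding sets[symmetric] using inverse by force
qed (use open_U open_V y_in inverse' der der' lip lip' in auto)

lemma linear_L: "linear L"
  using has_derivative_bounded_linear[OF der] by (rule bounded_linear.linear)

text \<open>Chain rule for \<open>\<Psi> \<circ> \<Phi>\<close>, which agrees with the identity on
  the open set \<open>U\<close> around \<open>x\<close>.\<close>

lemma L'_L: "L' (L v) = v"
proof -
  have "(\<Psi> \<circ> \<Phi> has_derivative L' \<circ> L) (at x)"
    by (rule diff_chain_at) (use der der' \<Phi>_x in auto)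
  then have "((\<lambda>z. z) has_derivative L' \<circ> L) (at x)"
    by (rule has_derivative_transform_within_open[OF _ open_U x_in]) (simp add: inverse)
  then have "L' \<circ> L = (\<lambda>z. z)" using has_derivative_unique has_derivative_ident by blast
  then show ?thesis by (metis comp_apply)
qed

lemma inj_L: "inj L"
  by (rule inj_on_inverseI[of _ L']) (simp add: L'_L)

lemma L_nonzero: "v \<noteq> 0 \<Longrightarrow> L v \<noteq> 0"
  using L'_L[of v] L'_L[of 0] linear_0[OF linear_L] by auto

text \<open>Normalisation is a nonzero scaling and keeps the line. On lines the induced map is
  therefore just the image under \<open>L\<close>.\<close>

lemma proj_class_image: "v \<noteq> 0 \<Longrightarrow> proj_class (sgn (L v)) = L ` proj_class v"
proof -
  assume "v \<noteq> 0"
  then have "span {sgn (L v)} = span {L v}"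
    unfolding sgn_div_norm using L_nonzero[of v] span_image_scale[of "{L v}" "\<lambda>_. inverse (norm (L v))"]
    by auto
  then show ?thesis
    unfolding proj_class_def using linear_span_image[OF linear_L, of "{v}"] by simp
qed

section \<open>Transport of directions, probes and contributions\<close>

lemma eff_dirs_image:
  assumes "v \<in> eff_dirs x A"
  shows "sgn (L v) \<in> eff_dirs y B"
proof -
  have v: "v \<in> tangent_cone x A" "norm v = 1"
    using assms unfolding eff_dirs_def by (auto split: if_splits)
  then obtain X l where X: "\<And>k::nat. X k \<in> A" "X \<longlonglongrightarrow> x"
    and l: "\<And>k. l k > (0::real)" "decseq l" "l \<longlonglongrightarrow> 0" and lim: "(\<lambda>k. (X k - x) /\<^sub>R l k) \<longlonglongrightarrow> v"
    unfolding tangent_cone_def by blast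
  have nz: "L v \<noteq> 0" using L_nonzero[of v] v(2) by force
  have lim': "(\<lambda>k. (\<Phi> (X k) - y) /\<^sub>R l k) \<longlonglongrightarrow> L v"
    using has_derivative_tendsto_scaled[OF der X(2) lim] \<Phi>_x by simp
  have \<Phi>X: "(\<lambda>k. \<Phi> (X k)) \<longlonglongrightarrow> y"
    using isCont_tendsto_compose[OF has_derivative_continuous[OF der] X(2)] \<Phi>_x by simp
  \<comment> \<open>Only points of \<open>A\<close> inside \<open>U\<close> are known to be sent
    into \<open>B\<close>, so an initial segment is dropped.\<close>
  obtain N where N: "\<And>k. k \<ge> N \<Longrightarrow> X k \<in> U"
    using topological_tendstoD[OF X(2) open_U x_in] unfolding eventually_sequentially by blast
  \<comment> \<open>The constant factor turns the limit \<open>L v\<close> into the unit vector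
    \<open>sgn (L v)\<close> and keeps the scales positive and decreasing to 0.\<close>
  define l' where "l' k = l (k + N) * norm (L v)" for k
  have "sgn (L v) \<in> tangent_cone y B" unfolding tangent_cone_def mem_Collect_eq
  proof (rule exI[of _ "\<lambda>k. \<Phi> (X (k + N))"], rule exI[of _ l'], intro conjI allI)
    show "\<Phi> (X (k + N)) \<in> B" for k
      using sets X(1)[of "k + N"] N[of "k + N"] by auto
    show "(\<lambda>k. \<Phi> (X (k + N))) \<longlonglongrightarrow> y" by (rule LIMSEQ_ignore_initial_segment[OF \<Phi>X])
    show "l' k > 0" for k using l(1) nz by (simp add: l'_def)
    show "decseq l'" using l(2) by (auto simp: decseq_def l'_def intro!: mult_right_mono)
    show "l' \<longlonglongrightarrow> 0" unfolding l'_def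
      using tendsto_mult_right[OF LIMSEQ_ignore_initial_segment[OF l(3), of N], of "norm (L v)"] by simp
    have "(\<lambda>k. ((\<Phi> (X (k + N)) - y) /\<^sub>R l (k + N)) /\<^sub>R norm (L v)) \<longlonglongrightarrow> L v /\<^sub>R norm (L v)"
      by (intro tendsto_scaleR tendsto_const LIMSEQ_ignore_initial_segment[OF lim'])
    then show "(\<lambda>k. (\<Phi> (X (k + N)) - y) /\<^sub>R l' k) \<longlonglongrightarrow> sgn (L v)"
      by (simp add: l'_def sgn_div_norm mult.commute)
  qed
  then show ?thesis
    using nz tangent_cone_imp_closure by (auto simp: eff_dirs_def norm_sgn)
qed

text \<open>The probe is shortened until it stays in \<open>U\<close> and in a ball where
  \<open>\<Phi>\<close> is Lipschitz; its new direction comes from the derivative at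
  \<open>x\<close>.\<close>

lemma probe_image:
  assumes probe: "(\<delta>, \<gamma>) \<in> probes x A v" and "v \<noteq> 0"
  obtains d where "0 < d" "d \<le> \<delta>" "\<gamma> ` {0..d} \<subseteq> U" "(d, \<Phi> \<circ> \<gamma>) \<in> probes y B (sgn (L v))"
proof -
  have \<delta>: "\<delta> > 0" and inj: "inj_on \<gamma> {0..\<delta>}" and \<gamma>0: "\<gamma> 0 = x"
    and dir: "((\<lambda>t. (\<gamma> t - x) /\<^sub>R norm (\<gamma> t - x)) \<longlongrightarrow> v) (at_right 0)"
    and meet: "\<And>\<eta>. \<eta> \<in> {0<..\<delta>} \<Longrightarrow> A \<inter> \<gamma> ` {0<..\<eta>} \<noteq> {}"
    using probe unfolding probes_def by auto
  obtain C where C: "C-lipschitz_on {0..\<delta>} \<gamma>" using probe unfolding probes_def by auto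
  obtain e M where e: "e > 0" and M: "M-lipschitz_on (ball x e) \<Phi>" using lip by blast
  have cont: "continuous_on {0..\<delta>} \<gamma>" by (rule lipschitz_on_continuous_on[OF C])
  obtain r where r: "r > 0" "ball x r \<subseteq> U" using open_U x_in open_contains_ball by blast
  have "min r e > 0" using r e by simp
  then obtain d0 where d0: "d0 > 0" "\<And>t. t \<in> {0..\<delta>} \<Longrightarrow> dist t 0 < d0 \<Longrightarrow> dist (\<gamma> t) (\<gamma> 0) < min r e"
    using cont \<delta> unfolding continuous_on_iff by (metis atLeastAtMost_iff order.refl less_imp_le)
  define d where "d = min \<delta> (d0 / 2)"
  have d: "0 < d" "d \<le> \<delta>" using \<delta> d0 by (auto simp: d_def)
  have near: "\<gamma> t \<in> ball x (min r e)" if "t \<in> {0..d}" for t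
    using d0(2)[of t] that d0(1) \<gamma>0 d_def by (auto simp: dist_commute)
  have U: "\<gamma> ` {0..d} \<subseteq> U" using near r by fastforce
  have "(\<gamma> \<longlongrightarrow> \<gamma> 0) (at 0 within {0..\<delta>})" using cont \<delta> by (auto simp: continuous_on_def)
  then have \<gamma>lim: "(\<gamma> \<longlongrightarrow> x) (at_right 0)" using \<delta> \<gamma>0 by (simp add: at_within_Icc_at_right)
  have nz: "L v \<noteq> 0" using L_nonzero \<open>v \<noteq> 0\<close> by blast
  \<comment> \<open>The derivative controls the quotient by \<open>norm (\<gamma> t - x)\<close>,
    whereas a probe needs the quotient by the norm of its own increment. Applying
    \<open>sgn\<close>, continuous at \<open>L v \<noteq> 0\<close>, removes the positive factor by
    which they differ.\<close>
  have "((\<lambda>t. sgn ((\<Phi> (\<gamma> t) - y) /\<^sub>R norm (\<gamma> t - x))) \<longlongrightarrow> sgn (L v)) (at_right 0)"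
    using tendsto_sgn[OF has_derivative_tendsto_scaled[OF der \<gamma>lim dir] nz] \<Phi>_x by simp
  moreover have "sgn ((\<Phi> (\<gamma> t) - y) /\<^sub>R norm (\<gamma> t - x)) = sgn (\<Phi> (\<gamma> t) - y)" for t
    using \<Phi>_x by (cases "\<gamma> t = x") (simp_all add: sgn_scaleR)
  ultimately have dir': "((\<lambda>t. sgn (\<Phi> (\<gamma> t) - y)) \<longlongrightarrow> sgn (L v)) (at_right 0)" by simp
  have "(d, \<Phi> \<circ> \<gamma>) \<in> probes y B (sgn (L v))"
    unfolding probes_def mem_Collect_eq prod.case
  proof (intro conjI ballI)
    have "inj_on \<gamma> {0..d}" by (rule inj_on_subset[OF inj]) (use d in auto)
    moreover have "inj_on \<Phi> (\<gamma> ` {0..d})"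
      by (rule inj_on_subset[OF _ U]) (metis inj_on_inverseI inverse)
    ultimately show "inj_on (\<Phi> \<circ> \<gamma>) {0..d}" by (rule comp_inj_on)
    have "(M * C)-lipschitz_on {0..d} (\<Phi> \<circ> \<gamma>)"
    proof (rule lipschitz_on_compose)
      show "C-lipschitz_on {0..d} \<gamma>" by (rule lipschitz_on_subset[OF C]) (use d in auto)
      show "M-lipschitz_on (\<gamma> ` {0..d}) \<Phi>"
        by (rule lipschitz_on_subset[OF M]) (use near in fastforce)
    qed
    then show "\<exists>K. K-lipschitz_on {0..d} (\<Phi> \<circ> \<gamma>)" ..
    show "B \<inter> (\<Phi> \<circ> \<gamma>) ` {0<..\<eta>} \<noteq> {}" if \<eta>: "\<eta> \<in> {0<..d}" for \<eta>
    proof -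
      have "\<eta> \<in> {0<..\<delta>}" using \<eta> d by auto
      then obtain t where t: "t \<in> {0<..\<eta>}" "\<gamma> t \<in> A" using meet by blast
      then have "\<gamma> t \<in> U" using \<eta> U by auto
      then have "\<Phi> (\<gamma> t) \<in> B" using t sets by blast
      then show ?thesis using t by auto
    qed
  qed (use d \<gamma>0 \<Phi>_x dir' in \<open>auto simp: sgn_scaleR_norm\<close>)
  with d U show ?thesis using that by blast
qed

text \<open>Near \<open>x\<close> the trace of \<open>A\<close> on a probe is contained in the
  \<open>\<Psi>\<close>-image of the trace of \<open>B\<close> on the image probe, and
  \<open>\<Psi>\<close> is Lipschitz near \<open>y\<close>.\<close>

lemma dir_contrib_image:
  assumes "v \<noteq> 0"
  shows "dir_contrib x A v \<le> dir_contrib y B (sgn (L v))"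
proof -
  have "point_box_dim x (A \<inter> \<gamma> ` {0..\<delta>}) \<le> dir_contrib y B (sgn (L v))"
    if probe: "(\<delta>, \<gamma>) \<in> probes x A v" for \<delta> \<gamma>
  proof -
    obtain d where d: "0 < d" "d \<le> \<delta>" "\<gamma> ` {0..d} \<subseteq> U"
      and probe': "(d, \<Phi> \<circ> \<gamma>) \<in> probes y B (sgn (L v))"
      using probe_image[OF probe assms] by blast
    obtain e M where e: "e > 0" and M: "M-lipschitz_on (ball y e) \<Psi>" using lip' by blast
    obtain C where C: "C-lipschitz_on {0..\<delta>} \<gamma>" using probe unfolding probes_def by auto
    have \<gamma>: "inj_on \<gamma> {0..\<delta>}" "\<gamma> 0 = x" using probe unfolding probes_def by auto
    obtain s where s: "s > 0" "\<And>t. t \<in> {0..\<delta>} \<Longrightarrow> dist (\<gamma> 0) (\<gamma> t) < s \<Longrightarrow> t < d"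
      using inj_path_start_germ[OF lipschitz_on_continuous_on[OF C] \<gamma>(1) d(1,2)] by blast
    have "point_box_dim x (A \<inter> \<gamma> ` {0..\<delta>}) \<le> point_box_dim y (B \<inter> (\<Phi> \<circ> \<gamma>) ` {0..d})"
    proof (rule point_box_dim_lipschitz_germ[OF probe_closure[OF probe] probe_closure[OF probe'] e M])
      fix r :: real assume "r > 0"
      then obtain s' where s': "s' > 0" "\<And>z. dist z x < s' \<Longrightarrow> dist (\<Phi> z) (\<Phi> x) < r"
        using has_derivative_continuous[OF der] unfolding continuous_at_eps_delta by blast
      \<comment> \<open>The radius \<open>s\<close> forces the parameter below \<open>d\<close>,
        hence onto the shortened probe; \<open>s'\<close> keeps the image within \<open>r\<close> of
        \<open>y\<close>.\<close>
      have "A \<inter> \<gamma> ` {0..\<delta>} \<inter> ball x (min s s') \<subseteq> \<Psi> ` (B \<inter> (\<Phi> \<circ> \<gamma>) ` {0..d} \<inter> ball y r)"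
      proof
        fix p assume p: "p \<in> A \<inter> \<gamma> ` {0..\<delta>} \<inter> ball x (min s s')"
        then obtain t where t: "t \<in> {0..\<delta>}" "p = \<gamma> t" by auto
        then have "t < d" using s(2)[of t] p \<gamma>(2) by auto
        then have td: "t \<in> {0..d}" using t by auto
        then have pU: "p \<in> U" using d(3) t by auto
        have "\<Phi> p \<in> B" using pU p sets by blast
        moreover have "\<Phi> p \<in> (\<Phi> \<circ> \<gamma>) ` {0..d}" using td t by auto
        moreover have "\<Phi> p \<in> ball y r" using s'(2)[of p] p \<Phi>_x by (auto simp: dist_commute)
        ultimately show "p \<in> \<Psi> ` (B \<inter> (\<Phi> \<circ> \<gamma>) ` {0..d} \<inter> ball y r)"
          using inverse[OF pU] by (metis IntI image_eqI)
      qed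
      then show "\<exists>s>0. A \<inter> \<gamma> ` {0..\<delta>} \<inter> ball x s \<subseteq> \<Psi> ` (B \<inter> (\<Phi> \<circ> \<gamma>) ` {0..d} \<inter> ball y r)"
        using s(1) s'(1) by (intro exI[of _ "min s s'"]) auto
    qed
    also have "\<dots> \<le> dir_contrib y B (sgn (L v))"
      unfolding dir_contrib_def by (rule SUP_upper2[OF probe']) simp
    finally show ?thesis .
  qed
  then show ?thesis unfolding dir_contrib_def[of x] by (intro SUP_least) auto
qed

lemma proj_contrib_image: "proj_contrib x A \<xi> \<le> proj_contrib y B (L ` \<xi>)"
  unfolding proj_contrib_def[of x]
proof (rule SUP_least)
  fix w assume "w \<in> {w \<in> eff_dirs x A. proj_class w = \<xi>}"
  then have w: "w \<in> eff_dirs x A" "proj_class w = \<xi>" by auto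
  then have "w \<noteq> 0" unfolding eff_dirs_def by (auto split: if_splits)
  then have "dir_contrib x A w \<le> dir_contrib y B (sgn (L w))" by (rule dir_contrib_image)
  also have "\<dots> \<le> proj_contrib y B (L ` \<xi>)"
    unfolding proj_contrib_def
    by (rule SUP_upper) (use w \<open>w \<noteq> 0\<close> eff_dirs_image proj_class_image in auto)
  finally show "dir_contrib x A w \<le> proj_contrib y B (L ` \<xi>)" .
qed

lemma proj_eff_dirs_image:
  assumes "\<xi> \<in> proj_eff_dirs x A"
  shows "L ` \<xi> \<in> proj_eff_dirs y B"
proof -
  obtain w where w: "w \<in> eff_dirs x A" "\<xi> = proj_class w"
    using assms unfolding proj_eff_dirs_def by auto
  then have "w \<noteq> 0" unfolding eff_dirs_def by (auto split: if_splits)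
  then show ?thesis
    using w eff_dirs_image[OF w(1)] proj_class_image[of w] unfolding proj_eff_dirs_def
    by (metis image_eqI)
qed

text \<open>Injectivity of \<open>L\<close> carries independent representatives to independent ones.
  As the two spaces have different types, the bound on \<open>m\<close> is obtained afresh in the
  target.\<close>

lemma proj_independent_image:
  assumes "proj_independent m \<xi>"
  shows "proj_independent m (\<lambda>i. L ` \<xi> i)" "m \<le> DIM('b)"
proof -
  obtain u where u: "\<And>i. i \<in> {1..m} \<Longrightarrow> u i \<noteq> 0 \<and> proj_class (u i) = \<xi> i"
    and inj: "inj_on u {1..m}" and ind: "independent (u ` {1..m})"
    using assms unfolding proj_independent_def by blast
  have inj': "inj_on (L \<circ> u) {1..m}"
    using inj inj_L by (intro comp_inj_on) (auto intro: inj_on_subset)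
  have ind': "independent ((L \<circ> u) ` {1..m})"
    unfolding image_comp[symmetric]
    by (rule linear_independent_injective_image[OF linear_L ind]) (rule inj_on_subset[OF inj_L], simp)
  have "(L \<circ> u) i \<noteq> 0 \<and> proj_class ((L \<circ> u) i) = L ` \<xi> i" if "i \<in> {1..m}" for i
  proof -
    have "proj_class (L (u i)) = L ` proj_class (u i)"
      unfolding proj_class_def using linear_span_image[OF linear_L, of "{u i}"] by simp
    then show ?thesis using u[OF that] L_nonzero[of "u i"] by simp
  qed
  then show "proj_independent m (\<lambda>i. L ` \<xi> i)"
    unfolding proj_independent_def using inj' ind' by blast
  show "m \<le> DIM('b)"
    using independent_bound[OF ind'] card_image[OF inj'] by simp
qed

lemma point_cross_dim_le: "point_cross_dim x A \<le> point_cross_dim y B"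
proof -
  have "(\<Sum>i=1..m. proj_contrib x A (\<xi> i)) \<le> point_cross_dim y B"
    if \<xi>: "\<And>i. i \<in> {1..m} \<Longrightarrow> \<xi> i \<in> proj_eff_dirs x A" and ind: "proj_independent m \<xi>" for m \<xi>
  proof -
    have "(\<Sum>i=1..m. proj_contrib x A (\<xi> i)) \<le> (\<Sum>i=1..m. proj_contrib y B (L ` \<xi> i))"
      by (intro sum_mono proj_contrib_image)
    also have "\<dots> \<le> point_cross_dim y B"
      unfolding point_cross_dim_def
      by (rule SUP_upper2[where i = "(m, \<lambda>i. L ` \<xi> i)"])
        (use \<xi> proj_eff_dirs_image proj_independent_image[OF ind] in auto)
    finally show ?thesis .
  qed
  then show ?thesis unfolding point_cross_dim_def[of x] by (intro SUP_least) auto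
qed

end

section \<open>Diffeomorphisms\<close>

text \<open>A continuous derivative is bounded on a compact ball, and the mean value inequality on
  the convex open ball makes that bound a Lipschitz constant.\<close>

lemma C1_on_local_lipschitz:
  assumes "open U" "C1_on U f" "x \<in> U"
  shows "\<exists>e>0. \<exists>M. M-lipschitz_on (ball x e) f"
proof -
  obtain f' where der: "\<And>z. z \<in> U \<Longrightarrow> (f has_derivative blinfun_apply (f' z)) (at z)"
    and cont: "continuous_on U f'"
    using assms(2) unfolding C1_on_def by blast
  obtain e where e: "e > 0" "cball x e \<subseteq> U" using assms open_contains_cball by blast
  have "compact (f' ` cball x e)"
    by (intro compact_continuous_image continuous_on_subset[OF cont e(2)]) simp
  from compact_imp_bounded[OF this]
  obtain K where K: "K > 0" "\<And>z. z \<in> cball x e \<Longrightarrow> norm (f' z) \<le> K"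
    unfolding bounded_pos by auto
  have "K-lipschitz_on (ball x e) f"
  proof (rule bounded_derivative_imp_lipschitz)
    show "(f has_derivative blinfun_apply (f' z)) (at z within ball x e)" if "z \<in> ball x e" for z
    proof -
      have "z \<in> U" using e(2) that by auto
      then show ?thesis by (rule has_derivative_at_withinI[OF der])
    qed
    show "onorm (blinfun_apply (f' z)) \<le> K" if "z \<in> ball x e" for z
      using K(2)[of z] that by (simp add: norm_blinfun.rep_eq)
  qed (use K in auto)
  then show ?thesis using e by blast
qed

theorem theorem4p7:
  fixes U V A B :: "(real ^ 'n) set" and \<Phi> :: "real ^ 'n \<Rightarrow> real ^ 'n" and x y :: "real ^ 'n"
  assumes "open U" and "open V"
    and "C1_diffeomorphism U V \<Phi>"
    and "x \<in> closure A \<inter> U"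
    and "y = \<Phi> x" and "B = \<Phi> ` (A \<inter> U)"
  shows "point_cross_dim y B = point_cross_dim x A"
proof -
  let ?\<Psi> = "inv_into U \<Phi>"
  have bij: "bij_betw \<Phi> U V" and C1: "C1_on U \<Phi>" "C1_on V ?\<Psi>"
    using assms(3) unfolding C1_diffeomorphism_def by auto
  have x: "x \<in> U" and y: "y \<in> V" using assms(4,5) bij bij_betwE by blast+
  obtain L where L: "(\<Phi> has_derivative L) (at x)" using C1(1) x unfolding C1_on_def by blast
  obtain L' where L': "(?\<Psi> has_derivative L') (at y)" using C1(2) y unfolding C1_on_def by blast
  interpret point_diffeo U V \<Phi> ?\<Psi> L L' x y A B
  proof
    show "\<Phi> ` U = V" using bij by (rule bij_betw_imp_surj_on)
    \<comment> \<open>Here \<open>B\<close> already lies in \<open>V\<close>; intersecting with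
      \<open>V\<close> only gives the relation its symmetric form.\<close>
    then show "\<Phi> ` (A \<inter> U) = B \<inter> V" using assms(6) by auto
    show "?\<Psi> (\<Phi> z) = z" if "z \<in> U" for z using bij_betw_inv_into_left[OF bij that] .
    show "\<exists>e>0. \<exists>M. M-lipschitz_on (ball x e) \<Phi>" by (rule C1_on_local_lipschitz[OF assms(1) C1(1) x])
    show "\<exists>e>0. \<exists>M. M-lipschitz_on (ball y e) ?\<Psi>" by (rule C1_on_local_lipschitz[OF assms(2) C1(2) y])
  qed (use assms x L L' in auto)
  show ?thesis
    \<comment> \<open>The reverse inequality is the same result for the inverse map.\<close>
    using point_cross_dim_le point_diffeo.point_cross_dim_le[OF swap] by (rule antisym[rotated])
qed

end
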